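(* Let $S$ be a semigroup. The intersection ideal graph $\Gamma(S)$ is disconnected if and only if $S$ is the union of exactly two minimal left ideals.
   Context: A left ideal of a semigroup $S$ is a non-empty subset $I\subseteq S$ with $SI\subseteq I$; it is nontrivial if $I\neq S$. The intersection of two left ideals is nontrivial if it is non-empty. Minimal left ideals are understood to be nontrivial: a nontrivial left ideal is minimal if it does not properly contain any left ideal of $S$. The intersection ideal graph $\Gamma(S)$ is the simple undirected graph whose vertices are the nontrivial left ideals of $S$, with two distinct vertices $I,J$ adjacent if and only if $I\cap J$ is nontrivial. A graph is disconnected if it has two vertices not joined by any path. "$S$ is the union of exactly two minimal left ideals" means $S=I_1\cup I_2$ for two distinct minimal left ideals $I_1,I_2$ of $S$. *)

theory Defs
  imports "Graph_Theory.Pair_Digraph"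
begin

text \<open>The semigroup \<open>S\<close> is the carrier \<open>UNIV\<close> of a type of class \<open>semigroup_mult\<close>.\<close>

definition left_ideal :: "'a::semigroup_mult set \<Rightarrow> bool" where
  "left_ideal I \<longleftrightarrow> I \<noteq> {} \<and> (\<forall>s. \<forall>x\<in>I. s * x \<in> I)"

definition nontrivial_left_ideal :: "'a::semigroup_mult set \<Rightarrow> bool" where
  "nontrivial_left_ideal I \<longleftrightarrow> left_ideal I \<and> I \<noteq> UNIV"

definition minimal_left_ideal :: "'a::semigroup_mult set \<Rightarrow> bool" where
  "minimal_left_ideal I \<longleftrightarrow> nontrivial_left_ideal I \<and> \<not> (\<exists>J. left_ideal J \<and> J \<subset> I)"

text \<open>As usual in the library, a simple undirected graph is a symmetric loop-free digraph
  without parallel arcs; it need not be finite.\<close>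

definition intersection_ideal_graph :: "'a::semigroup_mult set pair_pre_digraph" where
  "intersection_ideal_graph =
    \<lparr> pverts = {I. nontrivial_left_ideal I},
      parcs = {(I, J). nontrivial_left_ideal I \<and> nontrivial_left_ideal J \<and> I \<noteq> J \<and> I \<inter> J \<noteq> {}} \<rparr>"

lemma pair_bidirected_digraph_intersection_ideal_graph:
  "pair_bidirected_digraph (intersection_ideal_graph :: 'a::semigroup_mult set pair_pre_digraph)"
  by unfold_locales (auto simp: intersection_ideal_graph_def symmetric_def sym_def)

text \<open>Not the negation of the library's \<open>connected\<close>, which fails for the graph without
  vertices: that graph (here, of a semigroup without nontrivial left ideals) is not disconnected.\<close>

definition disconnected :: "('a, 'b) pre_digraph \<Rightarrow> bool" where
  "disconnected G \<longleftrightarrow> (\<exists>u\<in>verts G. \<exists>v\<in>verts G. \<not> (\<exists>p. pre_digraph.apath G u p v))"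

end

theory Submission
  imports Defs
begin

text \<open>If two nontrivial left ideals \<open>I\<close>, \<open>J\<close> are not joined by a path, then they are disjoint
  and, since \<open>I \<union> J\<close> is not a link between them, \<open>I \<union> J\<close> is the whole semigroup; a left
  ideal \<open>K\<close> properly inside \<open>I\<close> would give the path \<open>I\<close>, \<open>K\<close>, \<open>K \<union> J\<close>, \<open>J\<close>. Conversely, two
  distinct minimal left ideals are disjoint, and if they cover the semigroup they are its only
  nontrivial left ideals.\<close>

lemma left_ideal_Un: "left_ideal I \<Longrightarrow> left_ideal J \<Longrightarrow> left_ideal (I \<union> J)"
  by (auto simp: left_ideal_def)

lemma left_ideal_Int: "left_ideal I \<Longrightarrow> left_ideal J \<Longrightarrow> I \<inter> J \<noteq> {} \<Longrightarrow> left_ideal (I \<inter> J)"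
  by (auto simp: left_ideal_def)

text \<open>The intersection \<open>K \<inter> I\<close> is a left ideal inside \<open>I\<close>, so
  minimality forces it to be all of \<open>I\<close>.\<close>

lemma minimal_left_ideal_subset:
  assumes "minimal_left_ideal I" "left_ideal K" "K \<inter> I \<noteq> {}"
  shows "I \<subseteq> K"
  using assms left_ideal_Int[of K I]
  unfolding minimal_left_ideal_def nontrivial_left_ideal_def by blast

interpretation ideal_graph:
  pair_bidirected_digraph "intersection_ideal_graph :: 'a::semigroup_mult set pair_pre_digraph"
  by (rule pair_bidirected_digraph_intersection_ideal_graph)

abbreviation ideal_reachable :: "'a::semigroup_mult set \<Rightarrow> 'a set \<Rightarrow> bool" where
  "ideal_reachable I J \<equiv> I \<rightarrow>\<^sup>*\<^bsub>with_proj intersection_ideal_graph\<^esub> J"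

text \<open>Trades paths for reachability, which can be composed by transitivity, reversed by
  symmetry and used for induction.\<close>

lemma disconnected_ideal_graph_iff:
  "disconnected (with_proj (intersection_ideal_graph :: 'a::semigroup_mult set pair_pre_digraph)) \<longleftrightarrow>
    (\<exists>I J :: 'a set. nontrivial_left_ideal I \<and> nontrivial_left_ideal J \<and> \<not> ideal_reachable I J)"
  unfolding disconnected_def ideal_graph.reachable_apath
  by (auto simp: intersection_ideal_graph_def)

lemma ideal_reachable_if_Int:
  assumes "nontrivial_left_ideal I" "nontrivial_left_ideal J" "I \<inter> J \<noteq> {}"
  shows "ideal_reachable I J"
proof (cases "I = J")
  \<comment> \<open>The graph has no loops, so this case rests on reflexivity at the vertex
    \<open>I\<close> instead of on an arc.\<close>
  case True
  then show ?thesis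
    using assms(1) ideal_graph.reachable_refl[of I] by (simp add: intersection_ideal_graph_def)
next
  case False
  then show ?thesis
    using assms by (intro ideal_graph.reachable_adjI) (simp add: intersection_ideal_graph_def)
qed

lemma ideal_reachable_if_Un:
  assumes "nontrivial_left_ideal I" "nontrivial_left_ideal J" "I \<union> J \<noteq> UNIV"
  shows "ideal_reachable I J"
proof -
  have U: "nontrivial_left_ideal (I \<union> J)"
    using assms left_ideal_Un by (auto simp: nontrivial_left_ideal_def)
  have "I \<noteq> {}" "J \<noteq> {}"
    using assms by (auto simp: nontrivial_left_ideal_def left_ideal_def)
  then have "ideal_reachable I (I \<union> J)" "ideal_reachable (I \<union> J) J"
    using assms U by (auto intro!: ideal_reachable_if_Int)
  then show ?thesis
    by (rule ideal_graph.reachable_trans)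
qed

lemma ideal_reachable_if_not_minimal:
  assumes "nontrivial_left_ideal I" "nontrivial_left_ideal J" "\<not> minimal_left_ideal I"
  shows "ideal_reachable I J"
proof (cases "I \<inter> J = {}")
  case True
  from assms obtain K where K: "left_ideal K" "K \<subset> I"
    by (auto simp: minimal_left_ideal_def)
  \<comment> \<open>A point of \<open>I\<close> outside \<open>K\<close> is also outside
    \<open>J\<close>, as \<open>I\<close> and \<open>J\<close> are disjoint; hence
    \<open>K \<union> J\<close> is proper.\<close>
  then have "nontrivial_left_ideal K" "I \<inter> K \<noteq> {}" "K \<union> J \<noteq> UNIV"
    using True by (auto simp: nontrivial_left_ideal_def left_ideal_def)
  then have "ideal_reachable I K" "ideal_reachable K J"
    using assms by (auto intro: ideal_reachable_if_Int ideal_reachable_if_Un)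
  then show ?thesis
    by (rule ideal_graph.reachable_trans)
qed (use assms ideal_reachable_if_Int in blast)

lemma nontrivial_left_ideal_eq_if_cover:
  assumes "minimal_left_ideal I" "minimal_left_ideal J" "UNIV = I \<union> J"
    and "nontrivial_left_ideal K" "K \<inter> I \<noteq> {}"
  shows "K = I"
proof -
  have K: "left_ideal K" "K \<noteq> UNIV"
    using assms(4) by (auto simp: nontrivial_left_ideal_def)
  have "I \<subseteq> K"
    using minimal_left_ideal_subset assms(1,5) K(1) by blast
  \<comment> \<open>If \<open>K\<close> met \<open>J\<close>, it would contain \<open>J\<close> as
    well as \<open>I\<close>, hence everything.\<close>
  moreover have "K \<inter> J = {}"
    using minimal_left_ideal_subset[OF assms(2) K(1)] K(2) \<open>I \<subseteq> K\<close> assms(3) by blast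
  ultimately show ?thesis
    using assms(3) by blast
qed

text \<open>\<open>I\<close> is an isolated vertex: an arc from \<open>I\<close> would lead to a
  nontrivial left ideal meeting \<open>I\<close>, and the only such ideal is \<open>I\<close>
  itself.\<close>

lemma ideal_reachable_eq_if_cover:
  assumes "minimal_left_ideal I" "minimal_left_ideal J" "UNIV = I \<union> J"
    and "ideal_reachable I K"
  shows "K = I"
  using assms(4)
proof (induction rule: ideal_graph.reachable_induct)
  case (step K L)
  then have "nontrivial_left_ideal L" "L \<inter> I \<noteq> {}"
    by (auto simp: intersection_ideal_graph_def)
  then show ?case
    using nontrivial_left_ideal_eq_if_cover assms by blast
qed simp

theorem theorem3p3:
  shows "disconnected (with_proj (intersection_ideal_graph :: 'a::semigroup_mult set pair_pre_digraph)) \<longleftrightarrow>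
    (\<exists>I\<^sub>1 I\<^sub>2 :: 'a set. minimal_left_ideal I\<^sub>1 \<and> minimal_left_ideal I\<^sub>2 \<and> I\<^sub>1 \<noteq> I\<^sub>2 \<and> UNIV = I\<^sub>1 \<union> I\<^sub>2)"
  unfolding disconnected_ideal_graph_iff
proof (intro iffI; elim exE conjE)
  fix I J :: "'a set"
  assume I: "nontrivial_left_ideal I" and J: "nontrivial_left_ideal J"
    and IJ: "\<not> ideal_reachable I J"
  \<comment> \<open>Non-reachability in this direction gives the minimality of \<open>J\<close>,
    with the roles of the two ideals swapped.\<close>
  then have JI: "\<not> ideal_reachable J I"
    using ideal_graph.symmetric_reachable' by blast
  have "minimal_left_ideal I" "minimal_left_ideal J" "UNIV = I \<union> J"
    using I J IJ JI ideal_reachable_if_not_minimal ideal_reachable_if_Un by blast+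
  moreover have "I \<noteq> J"
    using \<open>UNIV = I \<union> J\<close> I by (auto simp: nontrivial_left_ideal_def)
  ultimately show "\<exists>I\<^sub>1 I\<^sub>2 :: 'a set.
      minimal_left_ideal I\<^sub>1 \<and> minimal_left_ideal I\<^sub>2 \<and> I\<^sub>1 \<noteq> I\<^sub>2 \<and> UNIV = I\<^sub>1 \<union> I\<^sub>2"
    by blast
next
  fix I J :: "'a set"
  assume "minimal_left_ideal I" "minimal_left_ideal J" "I \<noteq> J" "UNIV = I \<union> J"
  then show "\<exists>I J :: 'a set.
      nontrivial_left_ideal I \<and> nontrivial_left_ideal J \<and> \<not> ideal_reachable I J"
    using ideal_reachable_eq_if_cover unfolding minimal_left_ideal_def by metis
qed

end
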